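(* Let $k$ be $\mathbb{R}$ or $\mathbb{C}$, let $q\in k$ with $q\neq 0$ and $q^2\neq 1$, and let $s\in[0,1]$. Let $E_s$ be the left coalgebra line bundle over the quantum two-sphere $S^2_{qs}$, with projector $$ e_s=\frac{1}{1+s^2}\begin{pmatrix}1-\zeta & \xi\\ -\eta & s^2+q^{-2}\zeta\end{pmatrix} $$ (as defined in the context). Then the Chern number (monopole charge) of $E_s$ is $$\mathrm{ch}(E_s):=\tau^1(\mathrm{tr}\, e_s)=-1,$$ where $\tau^1$ is the Chern character functional on $S^2_{qs}$ described in the context; in particular it is independent of $s$.
   Context: $SU_q(2)$ is the unital associative $k$-algebra generated by $\alpha,\beta,\gamma,\delta$ subject to the relations $$\alpha\beta=q\beta\alpha,\quad \alpha\gamma=q\gamma\alpha,\quad \beta\gamma=\gamma\beta,\quad \beta\delta=q\delta\beta,\quad \gamma\delta=q\delta\gamma,$$ $$\alpha\delta=\delta\alpha+(q-q^{-1})\beta\gamma,\quad \alpha\delta-q\beta\gamma=1.$$ The quantum two-sphere $S^2_{qs}$ is the subalgebra of $SU_q(2)$ generated by $1$ and $$\xi=s(\alpha^2-q^{-1}\beta^2)+(s^2-1)q^{-1}\alpha\beta,\qquad \eta=s(q\gamma^2-\delta^2)+(s^2-1)\gamma\delta,$$ $$\zeta=s(q\alpha\gamma-\beta\delta)+(s^2-1)q\beta\gamma.$$ The line bundle over $S^2_{qs}$ is the left $S^2_{qs}$-module $$E_s=\{x(\alpha+s\beta)+y(\gamma+s\delta) : x,y\in S^2_{qs}\}\subseteq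 SU_q(2).$$ It is isomorphic to the finitely generated projective left module $(S^2_{qs})^2e_s=\{(x,y)e_s : x,y\in S^2_{qs}\}$ via $(x,y)e_s\mapsto x(\alpha+s\beta)+y(\gamma+s\delta)$, where $e_s^2=e_s$; i.e. $e_s$ is a projector of $E_s$. Here $\mathrm{tr}$ denotes the sum of the diagonal entries of a matrix. The functional $\tau^1:S^2_{qs}\to k$ is the Chern character of $S^2_{qs}$ known from the literature (Masuda, Nakagami and Watanabe). It is a linear trace functional, with values $$\tau^1(1)=0,\qquad \tau^1(\zeta)=\frac{1+s^2}{1-q^{-2}}.$$ *)

theory Defs
  imports
    Complex_Main
    "HOL-Library.Poly_Mapping"
    "HOL-Algebra.QuotRing"
    "HOL-Algebra.Generated_Rings"
begin

section \<open>The free algebra on four generators\<close>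

text \<open>
  Words form a monoid, written additively because the convolution product of
  finitely supported functions is declared for \<^class>\<open>monoid_add\<close> exponents.
  The free unital associative algebra is the monoid algebra of that monoid.

  The ground field is of class \<^class>\<open>real_normed_field\<close>: up to isomorphism over the
  reals, \<open>\<real>\<close> and \<open>\<complex>\<close> are the only such fields (Gelfand-Mazur).
\<close>

datatype letter = Alpha | Beta | Gamma | Delta

instantiation list :: (type) monoid_add
begin

definition zero_list :: "'a list" where "zero_list = []"

definition plus_list :: "'a list \<Rightarrow> 'a list \<Rightarrow> 'a list" where "plus_list u v = u @ v"

instance by standard (simp_all add: zero_list_def plus_list_def)

end

type_synonym 'k free = "letter list \<Rightarrow>\<^sub>0 'k"

definition gen :: "letter \<Rightarrow> 'k::real_normed_field free" where
  "gen g = Poly_Mapping.single [g] 1"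

definition scalar :: "'k::real_normed_field \<Rightarrow> 'k free" where
  "scalar c = Poly_Mapping.single [] c"

definition free_algebra :: "'k::real_normed_field free ring" where
  "free_algebra = \<lparr>carrier = UNIV, mult = (*), one = 1, zero = 0, add = (+)\<rparr>"


section \<open>The quantum group and the quantum two-sphere\<close>

definition SUq2_relations :: "'k::real_normed_field \<Rightarrow> 'k free set" where
  "SUq2_relations q =
    (let a = gen Alpha; b = gen Beta; c = gen Gamma; d = gen Delta in
     {a * b - scalar q * b * a,
      a * c - scalar q * c * a,
      b * c - c * b,
      b * d - scalar q * d * b,
      c * d - scalar q * d * c,
      a * d - (d * a + scalar (q - inverse q) * b * c),
      a * d - scalar q * b * c - 1})"

definition SUq2_ideal :: "'k::real_normed_field \<Rightarrow> 'k free set" where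
  "SUq2_ideal q = genideal free_algebra (SUq2_relations q)"

definition SUq2 :: "'k::real_normed_field \<Rightarrow> 'k free set ring" where
  "SUq2 q = free_algebra Quot (SUq2_ideal q)"

definition cls :: "'k::real_normed_field \<Rightarrow> 'k free \<Rightarrow> 'k free set" where
  "cls q x = SUq2_ideal q +>\<^bsub>free_algebra\<^esub> x"

definition scale :: "'k::real_normed_field \<Rightarrow> 'k \<Rightarrow> 'k free set \<Rightarrow> 'k free set" where
  "scale q c x = cls q (scalar c) \<otimes>\<^bsub>SUq2 q\<^esub> x"

definition xi :: "'k::real_normed_field \<Rightarrow> real \<Rightarrow> 'k free set" where
  "xi q s =
    (let a = gen Alpha; b = gen Beta; t = of_real s in
     cls q (scalar t * (a^2 - scalar (inverse q) * b^2)
            + scalar ((t^2 - 1) * inverse q) * a * b))"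

definition eta :: "'k::real_normed_field \<Rightarrow> real \<Rightarrow> 'k free set" where
  "eta q s =
    (let c = gen Gamma; d = gen Delta; t = of_real s in
     cls q (scalar t * (scalar q * c^2 - d^2) + scalar (t^2 - 1) * c * d))"

definition zeta :: "'k::real_normed_field \<Rightarrow> real \<Rightarrow> 'k free set" where
  "zeta q s =
    (let a = gen Alpha; b = gen Beta; c = gen Gamma; d = gen Delta; t = of_real s in
     cls q (scalar t * (scalar q * a * c - b * d) + scalar ((t^2 - 1) * q) * b * c))"

text \<open>The scalars are adjoined so that the generated subring is a subalgebra.\<close>

definition sphere :: "'k::real_normed_field \<Rightarrow> real \<Rightarrow> 'k free set set" where
  "sphere q s =
    generate_ring (SUq2 q) (range (\<lambda>c. cls q (scalar c)) \<union> {xi q s, eta q s, zeta q s})"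


section \<open>Two-by-two matrices and projectors\<close>

text \<open>A matrix is the pair of its rows; the base ring need not be commutative.\<close>

type_synonym 'a row2 = "'a \<times> 'a"
type_synonym 'a mat2 = "'a row2 \<times> 'a row2"

definition row_add :: "('a, 'm) ring_scheme \<Rightarrow> 'a row2 \<Rightarrow> 'a row2 \<Rightarrow> 'a row2" where
  "row_add R p r = (fst p \<oplus>\<^bsub>R\<^esub> fst r, snd p \<oplus>\<^bsub>R\<^esub> snd r)"

definition row_scale :: "('a, 'm) ring_scheme \<Rightarrow> 'a \<Rightarrow> 'a row2 \<Rightarrow> 'a row2" where
  "row_scale R r p = (r \<otimes>\<^bsub>R\<^esub> fst p, r \<otimes>\<^bsub>R\<^esub> snd p)"

definition row_mat :: "('a, 'm) ring_scheme \<Rightarrow> 'a row2 \<Rightarrow> 'a mat2 \<Rightarrow> 'a row2" where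
  "row_mat R p A = row_add R (row_scale R (fst p) (fst A)) (row_scale R (snd p) (snd A))"

definition mat_mult :: "('a, 'm) ring_scheme \<Rightarrow> 'a mat2 \<Rightarrow> 'a mat2 \<Rightarrow> 'a mat2" where
  "mat_mult R A B = (row_mat R (fst A) B, row_mat R (snd A) B)"

definition mat_tr :: "('a, 'm) ring_scheme \<Rightarrow> 'a mat2 \<Rightarrow> 'a" where
  "mat_tr R A = fst (fst A) \<oplus>\<^bsub>R\<^esub> snd (snd A)"

text \<open>
  For a subring \<open>S\<close> of \<open>R\<close> and the left \<open>S\<close>-submodule \<open>E\<close> of \<open>R\<close> generated by \<open>u\<close> and \<open>v\<close>,
  \<open>e\<close> is a projector of \<open>E\<close> if it is idempotent over \<open>S\<close> and \<open>(x, y) e \<mapsto> x u + y v\<close> is a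
  well-defined isomorphism of left \<open>S\<close>-modules from \<open>S\<^sup>2 e\<close> onto \<open>E\<close>.
\<close>

definition row_module :: "('a, 'm) ring_scheme \<Rightarrow> 'a set \<Rightarrow> 'a mat2 \<Rightarrow> 'a row2 set" where
  "row_module R S e = {row_mat R p e | p. p \<in> S \<times> S}"

definition left_module_iso ::
  "('a, 'm) ring_scheme \<Rightarrow> 'a set \<Rightarrow> 'a row2 set \<Rightarrow> 'a set \<Rightarrow> ('a row2 \<Rightarrow> 'a) \<Rightarrow> bool" where
  "left_module_iso R S M N f \<longleftrightarrow>
     bij_betw f M N \<and>
     (\<forall>m\<in>M. \<forall>m'\<in>M. f (row_add R m m') = f m \<oplus>\<^bsub>R\<^esub> f m') \<and>
     (\<forall>r\<in>S. \<forall>m\<in>M. f (row_scale R r m) = r \<otimes>\<^bsub>R\<^esub> f m)"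

definition is_projector ::
  "('a, 'm) ring_scheme \<Rightarrow> 'a set \<Rightarrow> 'a \<Rightarrow> 'a \<Rightarrow> 'a set \<Rightarrow> 'a mat2 \<Rightarrow> bool" where
  "is_projector R S u v E e \<longleftrightarrow>
     e \<in> (S \<times> S) \<times> (S \<times> S) \<and>
     mat_mult R e e = e \<and>
     (\<exists>f. left_module_iso R S (row_module R S e) E f \<and>
          (\<forall>x\<in>S. \<forall>y\<in>S. f (row_mat R (x, y) e) = x \<otimes>\<^bsub>R\<^esub> u \<oplus>\<^bsub>R\<^esub> y \<otimes>\<^bsub>R\<^esub> v))"


section \<open>The line bundle and its Chern number\<close>

definition bundle_gen1 :: "'k::real_normed_field \<Rightarrow> real \<Rightarrow> 'k free set" where
  "bundle_gen1 q s = cls q (gen Alpha + scalar (of_real s) * gen Beta)"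

definition bundle_gen2 :: "'k::real_normed_field \<Rightarrow> real \<Rightarrow> 'k free set" where
  "bundle_gen2 q s = cls q (gen Gamma + scalar (of_real s) * gen Delta)"

definition line_bundle :: "'k::real_normed_field \<Rightarrow> real \<Rightarrow> 'k free set set" where
  "line_bundle q s =
    {x \<otimes>\<^bsub>SUq2 q\<^esub> bundle_gen1 q s \<oplus>\<^bsub>SUq2 q\<^esub> y \<otimes>\<^bsub>SUq2 q\<^esub> bundle_gen2 q s | x y.
      x \<in> sphere q s \<and> y \<in> sphere q s}"

definition line_bundle_projector :: "'k::real_normed_field \<Rightarrow> real \<Rightarrow> 'k free set mat2" where
  "line_bundle_projector q s =
    (let R = SUq2 q; n = inverse (1 + (of_real s)^2) in
     ((scale q n (\<one>\<^bsub>R\<^esub> \<ominus>\<^bsub>R\<^esub> zeta q s), scale q n (xi q s)),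
      (scale q n (\<ominus>\<^bsub>R\<^esub> eta q s),
       scale q n (cls q (scalar ((of_real s)^2)) \<oplus>\<^bsub>R\<^esub> scale q ((inverse q)^2) (zeta q s)))))"

text \<open>Only the values on \<open>S\<close> matter; \<open>\<tau>\<close> is unconstrained elsewhere.\<close>

definition linear_trace :: "'k::real_normed_field \<Rightarrow> 'k free set set \<Rightarrow> ('k free set \<Rightarrow> 'k) \<Rightarrow> bool" where
  "linear_trace q S \<tau> \<longleftrightarrow>
     (\<forall>x\<in>S. \<forall>y\<in>S. \<tau> (x \<oplus>\<^bsub>SUq2 q\<^esub> y) = \<tau> x + \<tau> y) \<and>
     (\<forall>c. \<forall>x\<in>S. \<tau> (scale q c x) = c * \<tau> x) \<and>
     (\<forall>x\<in>S. \<forall>y\<in>S. \<tau> (x \<otimes>\<^bsub>SUq2 q\<^esub> y) = \<tau> (y \<otimes>\<^bsub>SUq2 q\<^esub> x))"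

definition chern_number ::
  "'k::real_normed_field \<Rightarrow> ('k free set \<Rightarrow> 'k) \<Rightarrow> 'k free set mat2 \<Rightarrow> 'k" where
  "chern_number q \<tau> e = \<tau> (mat_tr (SUq2 q) e)"

end

theory Submission
  imports Defs
begin

text \<open>
  The projector has rank one because it factors as a column times a row. Let \<open>(u, v)\<close> be the
  generators \<open>\<alpha> + s \<beta>\<close>, \<open>\<gamma> + s \<delta>\<close> of the line bundle; they form the column
  \<open>(\<alpha> \<beta>; \<gamma> \<delta>) (1, s)\<^sup>T\<close>. The quantum matrix \<open>(\<alpha> \<beta>; \<gamma> \<delta>)\<close> is inverted by
  its antipode \<open>(\<delta> -q\<inverse>\<beta>; -q\<gamma> \<alpha>)\<close>, so the row
  \<open>(w1, w2) = (1 + s\<^sup>2)\<inverse> (1, s) (\<delta> -q\<inverse>\<beta>; -q\<gamma> \<alpha>)\<close> satisfies \<open>w1 u + w2 v = 1\<close>.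
  Multiplying out the column \<open>(u, v)\<close> times the row \<open>(w1, w2)\<close> and reordering with the defining
  relations gives exactly \<open>e\<^sub>s\<close> (\<open>rank_one_entries\<close>).

  Everything about \<open>e\<^sub>s\<close> follows from this factorisation over any ring
  (\<open>is_projector_of_dual_pair\<close>): since \<open>(x, y) e\<^sub>s = (x u + y v) (w1, w2)\<close>, multiplying by the
  column \<open>(u, v)\<close> undoes multiplication by the row \<open>(w1, w2)\<close>.

  The charge is linear algebra: \<open>tr e\<^sub>s = 1 + (1 + s\<^sup>2)\<inverse> (q\<^sup>-\<^sup>2 - 1) \<zeta>\<close>, on which
  \<open>\<tau>\<close> takes the value \<open>(q\<^sup>-\<^sup>2 - 1) / (1 - q\<^sup>-\<^sup>2) = -1\<close>.
\<close>


section \<open>Projectors from a dual pair of generators\<close>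

text \<open>
  Right multiplication by \<open>(w1, w2)\<close> embeds \<open>S u + S v\<close> into \<open>R\<^sup>2\<close> with image \<open>S\<^sup>2 e\<close>, and
  \<open>m \<mapsto> m\<^sub>1 u + m\<^sub>2 v\<close> is a left inverse by duality. In the application \<open>u\<close>, \<open>v\<close>,
  \<open>w1\<close>, \<open>w2\<close> have odd degree in the generators while \<open>S\<close> is even, hence the distinction
  between \<open>R\<close> and \<open>S\<close>.
\<close>

lemma (in ring) is_projector_of_dual_pair:
  assumes S: "subring S R"
    and carr: "u \<in> carrier R" "v \<in> carrier R" "w1 \<in> carrier R" "w2 \<in> carrier R"
    and dual: "w1 \<otimes> u \<oplus> w2 \<otimes> v = \<one>"
    and e: "e = ((u \<otimes> w1, u \<otimes> w2), (v \<otimes> w1, v \<otimes> w2))"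
    and eS: "u \<otimes> w1 \<in> S" "u \<otimes> w2 \<in> S" "v \<otimes> w1 \<in> S" "v \<otimes> w2 \<in> S"
  shows "is_projector R S u v {x \<otimes> u \<oplus> y \<otimes> v | x y. x \<in> S \<and> y \<in> S} e"
proof -
  note [simp] = carr
  have SR: "x \<in> S \<Longrightarrow> x \<in> carrier R" for x
    using S subringE(1) by blast
  define f where "f m = fst m \<otimes> u \<oplus> snd m \<otimes> v" for m
  have row: "row_mat R (x, y) e = ((x \<otimes> u \<oplus> y \<otimes> v) \<otimes> w1, (x \<otimes> u \<oplus> y \<otimes> v) \<otimes> w2)"
    if "x \<in> carrier R" "y \<in> carrier R" for x y
    using that by (simp add: e row_mat_def row_add_def row_scale_def l_distr m_assoc)
  have fz: "f (z \<otimes> w1, z \<otimes> w2) = z" if "z \<in> carrier R" for z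
  proof -
    have "f (z \<otimes> w1, z \<otimes> w2) = z \<otimes> (w1 \<otimes> u \<oplus> w2 \<otimes> v)"
      using that by (simp add: f_def r_distr m_assoc)
    then show ?thesis
      using that by (simp add: dual)
  qed
  have fe: "f (row_mat R (x, y) e) = x \<otimes> u \<oplus> y \<otimes> v" if "x \<in> S" "y \<in> S" for x y
    using that SR by (simp add: row fz)
  have idem: "mat_mult R e e = e"
  proof -
    have "(z \<otimes> w1) \<otimes> u \<oplus> (z \<otimes> w2) \<otimes> v = z" if "z \<in> carrier R" for z
      using fz[OF that] by (simp add: f_def)
    then show ?thesis
      using row[of "u \<otimes> w1" "u \<otimes> w2"] row[of "v \<otimes> w1" "v \<otimes> w2"]
      by (simp add: mat_mult_def) (simp add: e)
  qed
  have MC: "fst m \<in> carrier R \<and> snd m \<in> carrier R" if "m \<in> row_module R S e" for m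
    using that SR by (auto simp: row_module_def row)
  have bij: "bij_betw f (row_module R S e) {x \<otimes> u \<oplus> y \<otimes> v | x y. x \<in> S \<and> y \<in> S}"
  proof (rule bij_betw_imageI)
    show "inj_on f (row_module R S e)"
    proof (rule inj_onI)
      fix m m'
      assume "m \<in> row_module R S e" "m' \<in> row_module R S e" and eq: "f m = f m'"
      then obtain x y x' y' where S4: "x \<in> S" "y \<in> S" "x' \<in> S" "y' \<in> S"
        and m: "m = row_mat R (x, y) e" "m' = row_mat R (x', y') e"
        by (auto simp: row_module_def)
      with eq have "x \<otimes> u \<oplus> y \<otimes> v = x' \<otimes> u \<oplus> y' \<otimes> v"
        by (simp add: fe)
      with S4 SR show "m = m'"
        by (simp add: m row)
    qed
    show "f ` row_module R S e = {x \<otimes> u \<oplus> y \<otimes> v | x y. x \<in> S \<and> y \<in> S}"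
      (is "_ = ?E")
    proof
      show "f ` row_module R S e \<subseteq> ?E"
        by (auto simp: row_module_def fe) blast
      show "?E \<subseteq> f ` row_module R S e"
      proof
        fix z assume "z \<in> ?E"
        then obtain x y where "x \<in> S" "y \<in> S" "z = f (row_mat R (x, y) e)"
          by (auto simp: fe)
        then show "z \<in> f ` row_module R S e"
          by (auto simp: row_module_def)
      qed
    qed
  qed
  have "left_module_iso R S (row_module R S e) {x \<otimes> u \<oplus> y \<otimes> v | x y. x \<in> S \<and> y \<in> S} f"
    unfolding left_module_iso_def
  proof (intro conjI ballI bij)
    fix m m' assume "m \<in> row_module R S e" "m' \<in> row_module R S e"
    then show "f (row_add R m m') = f m \<oplus> f m'"
      using MC[of m] MC[of m'] by (simp add: f_def row_add_def l_distr a_ac)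
  next
    fix r m assume "r \<in> S" "m \<in> row_module R S e"
    then show "f (row_scale R r m) = r \<otimes> f m"
      using MC[of m] SR[of r] by (simp add: f_def row_scale_def r_distr m_assoc)
  qed
  with fe idem eS show ?thesis
    unfolding is_projector_def by (auto simp: e)
qed


section \<open>Passing from words to the quantum group\<close>

lemma ring_free_algebra: "ring (free_algebra :: 'k::real_normed_field free ring)"
proof (rule ringI)
  show "abelian_group (free_algebra :: 'k free ring)"
    by (rule abelian_groupI) (auto simp: free_algebra_def add_ac intro: exI[of _ "- x" for x] left_minus)
  show "monoid (free_algebra :: 'k free ring)"
    by unfold_locales (auto simp: free_algebra_def mult.assoc)
qed (auto simp: free_algebra_def distrib_left distrib_right)

lemma ideal_SUq2: "ideal (SUq2_ideal q) free_algebra"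
  unfolding SUq2_ideal_def
  by (rule ring.genideal_ideal[OF ring_free_algebra]) (simp add: free_algebra_def)

lemma SUq2_ideal_simps:
  "x \<in> SUq2_relations q \<Longrightarrow> x \<in> SUq2_ideal q"
  "x \<in> SUq2_ideal q \<Longrightarrow> y \<in> SUq2_ideal q \<Longrightarrow> x + y \<in> SUq2_ideal q"
  "x \<in> SUq2_ideal q \<Longrightarrow> y * x \<in> SUq2_ideal q"
proof -
  interpret ideal "SUq2_ideal q" free_algebra
    by (rule ideal_SUq2)
  show "x \<in> SUq2_relations q \<Longrightarrow> x \<in> SUq2_ideal q"
    unfolding SUq2_ideal_def
    using ring.genideal_self[OF ring_free_algebra, of "SUq2_relations q"]
    by (auto simp: free_algebra_def)
  show "x \<in> SUq2_ideal q \<Longrightarrow> y \<in> SUq2_ideal q \<Longrightarrow> x + y \<in> SUq2_ideal q"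
    using additive_subgroup.a_closed[OF additive_subgroup_axioms, of x y]
    by (simp add: free_algebra_def)
  show "x \<in> SUq2_ideal q \<Longrightarrow> y * x \<in> SUq2_ideal q"
    using I_l_closed[of x y] by (simp add: free_algebra_def)
qed

lemma ring_SUq2: "ring (SUq2 q)"
  unfolding SUq2_def by (rule ideal.quotient_is_ring[OF ideal_SUq2])

lemma cls_hom: "cls q \<in> ring_hom free_algebra (SUq2 q)"
  unfolding SUq2_def cls_def by (rule ideal.rcos_ring_hom[OF ideal_SUq2])

lemma cls_carrier [simp]: "cls q x \<in> carrier (SUq2 q)"
  using ring_hom_closed[OF cls_hom, of x q] by (simp add: free_algebra_def)

lemma cls_mult: "cls q x \<otimes>\<^bsub>SUq2 q\<^esub> cls q y = cls q (x * y)"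
  using ring_hom_mult[OF cls_hom, of x y q] by (simp add: free_algebra_def)

lemma cls_add: "cls q x \<oplus>\<^bsub>SUq2 q\<^esub> cls q y = cls q (x + y)"
  using ring_hom_add[OF cls_hom, of x y q] by (simp add: free_algebra_def)

lemma cls_one: "\<one>\<^bsub>SUq2 q\<^esub> = cls q 1"
  using ring_hom_one[OF cls_hom, of q] by (simp add: free_algebra_def)

lemma cls_zero: "\<zero>\<^bsub>SUq2 q\<^esub> = cls q 0"
  using ring_hom_zero[OF cls_hom ring_free_algebra ring_SUq2, of q] by (simp add: free_algebra_def)

lemma cls_uminus: "\<ominus>\<^bsub>SUq2 q\<^esub> cls q x = cls q (- x)"
proof -
  interpret ring "SUq2 q" by (rule ring_SUq2)
  show ?thesis
    by (rule minus_equality) (simp_all add: cls_add cls_zero)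
qed

lemma cls_minus: "cls q x \<ominus>\<^bsub>SUq2 q\<^esub> cls q y = cls q (x - y)"
  by (simp add: a_minus_def cls_uminus cls_add)

lemmas cls_ring_simps = cls_mult cls_add cls_one cls_uminus cls_minus

text \<open>Stated with an explicit remainder, so that each identity in the quantum group becomes an
  identity of words together with the combination of relations that witnesses it.\<close>

lemma cls_eqI:
  assumes "x = y + r" "r \<in> SUq2_ideal q"
  shows "cls q x = cls q y"
proof -
  interpret ideal "SUq2_ideal q" free_algebra
    by (rule ideal_SUq2)
  have "x \<in> cls q y"
    using assms by (auto simp: cls_def a_r_coset_def' free_algebra_def add_ac)
  then show ?thesis
    using a_repr_independence'[of x y] by (auto simp: cls_def free_algebra_def)
qed


section \<open>The rank-one factorisation of the projector\<close>

lemma scalar_hom: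
  "scalar (c * d) = scalar c * scalar d"
  "scalar (c + d) = scalar c + scalar d"
  "scalar (c - d) = scalar c - scalar d"
  "scalar 1 = 1"
  by (simp_all add: scalar_def mult_single plus_list_def single_add single_diff)
    (simp flip: zero_list_def)

lemma scalar_commute:
  "scalar c * scalar d = scalar d * scalar c"
  "gen g * scalar c = scalar c * gen g"
  by (simp_all add: scalar_def gen_def mult_single plus_list_def mult.commute)

lemma scalar_left_commute:
  "scalar c * (scalar d * x) = scalar d * (scalar c * x)"
  "gen g * (scalar c * x) = scalar c * (gen g * x)"
  by (simp_all only: scalar_commute flip: mult.assoc)

lemma scalar_inverse_cancel:
  assumes "p * q = 1"
  shows "scalar p * scalar q = 1" "scalar q * scalar p = 1"
    "scalar p * (scalar q * x) = x" "scalar q * (scalar p * x) = x"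
  using assms
  by (simp_all add: mult.commute scalar_hom(4) flip: scalar_hom(1) mult.assoc)

lemmas scalar_normalize =
  scalar_hom scalar_commute scalar_left_commute power2_eq_square algebra_simps

lemma SUq2_relations_in_ideal:
  fixes q :: "'k::real_normed_field"
  defines "a \<equiv> gen Alpha" and "b \<equiv> gen Beta" and "c \<equiv> gen Gamma" and "d \<equiv> gen Delta"
  shows "a * b - scalar q * b * a \<in> SUq2_ideal q"
    "a * c - scalar q * c * a \<in> SUq2_ideal q"
    "b * c - c * b \<in> SUq2_ideal q"
    "b * d - scalar q * d * b \<in> SUq2_ideal q"
    "c * d - scalar q * d * c \<in> SUq2_ideal q"
    "a * d - (d * a + scalar (q - inverse q) * b * c) \<in> SUq2_ideal q"
    "a * d - scalar q * b * c - 1 \<in> SUq2_ideal q"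
  by (rule SUq2_ideal_simps(1); simp add: SUq2_relations_def Let_def assms)+

text \<open>
  The \<open>w1\<close>, \<open>w2\<close> here are \<open>1 + t\<^sup>2\<close> times the dual row, which keeps denominators out of the
  word calculations. Each equation is a combination of the defining relations with scalar
  coefficients: all terms are quadratic, so no relation has to be multiplied by a generator.
\<close>

lemma rank_one_entries:
  fixes q p t :: "'k::real_normed_field"
  defines "a \<equiv> gen Alpha" and "b \<equiv> gen Beta" and "c \<equiv> gen Gamma" and "d \<equiv> gen Delta"
  defines "u \<equiv> a + scalar t * b" and "v \<equiv> c + scalar t * d"
  defines "w1 \<equiv> d - scalar (t * q) * c" and "w2 \<equiv> scalar t * a - scalar p * b"
  defines "x \<equiv> scalar t * (a^2 - scalar p * b^2) + scalar ((t^2 - 1) * p) * a * b"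
    and "y \<equiv> scalar t * (scalar q * c^2 - d^2) + scalar (t^2 - 1) * c * d"
    and "z \<equiv> scalar t * (scalar q * a * c - b * d) + scalar ((t^2 - 1) * q) * b * c"
  assumes p: "p = inverse q" and q: "q \<noteq> 0"
  shows "cls q (u * w1) = cls q (1 - z)"
    "cls q (u * w2) = cls q x"
    "cls q (v * w1) = cls q (- y)"
    "cls q (v * w2) = cls q (scalar (t^2) + scalar (p^2) * z)"
    "cls q (w1 * u + w2 * v) = cls q (scalar (1 + t^2))"
proof -
  have pq: "p * q = 1"
    using p q by simp
  note cancel = scalar_inverse_cancel[OF pq]
  define r1 r2 r3 r4 r5 r6 r7 where r:
    "r1 = a * b - scalar q * b * a" "r2 = a * c - scalar q * c * a" "r3 = b * c - c * b"
    "r4 = b * d - scalar q * d * b" "r5 = c * d - scalar q * d * c"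
    "r6 = a * d - (d * a + scalar (q - p) * b * c)" "r7 = a * d - scalar q * b * c - 1"
  have I: "r1 \<in> SUq2_ideal q" "r2 \<in> SUq2_ideal q" "r3 \<in> SUq2_ideal q" "r4 \<in> SUq2_ideal q"
    "r5 \<in> SUq2_ideal q" "r6 \<in> SUq2_ideal q" "r7 \<in> SUq2_ideal q"
    using SUq2_relations_in_ideal[of q] by (simp_all add: r a_def b_def c_def d_def p)
  note defs = u_def v_def w1_def w2_def x_def y_def z_def r
  have comm: "g * scalar k = scalar k * g" "g * (scalar k * h) = scalar k * (g * h)"
    if "g \<in> {a, b, c, d}" for g h k
    using that scalar_commute(2) scalar_left_commute(2)
    by (auto simp: a_def b_def c_def d_def)
  note norm = defs comm cancel scalar_hom scalar_commute(1) scalar_left_commute(1)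
    power2_eq_square algebra_simps
  note clos = SUq2_ideal_simps(2,3) I
  show "cls q (u * w1) = cls q (1 - z)"
    by (rule cls_eqI[where r = r7]) (simp add: norm, intro clos)
  show "cls q (u * w2) = cls q x"
    by (rule cls_eqI[where r = "(- scalar (t^2 * p)) * r1"]) (simp add: norm, intro clos)
  show "cls q (v * w1) = cls q (- y)"
    by (rule cls_eqI[where r = "scalar (t^2) * r5"]) (simp add: norm, intro clos)
  show "cls q (v * w2) = cls q (scalar (t^2) + scalar (p^2) * z)"
    \<comment> \<open>\<open>r7 - r6\<close> is the other determinant relation \<open>\<delta>\<alpha> - q\<inverse>\<beta>\<gamma> = 1\<close>.\<close>
    by (rule cls_eqI[where r = "(- scalar (t * p)) * r2 + scalar p * r3
          + scalar (t^2) * (r7 + (- 1) * r6) + scalar (t * p^2) * r4"])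
      (simp add: norm, intro clos)
  show "cls q (w1 * u + w2 * v) = cls q (scalar (1 + t^2))"
    by (rule cls_eqI[where r = "r7 + (- 1) * r6 + (- scalar (t * p)) * r4 + scalar t * r2
          + scalar (t^2) * (r7 + scalar q * r3)"])
      (simp add: norm, intro clos)
qed

lemma one_plus_of_real_square_neq_0: "1 + (of_real s)^2 \<noteq> (0 :: 'k::real_normed_field)"
proof -
  have "1 + s^2 \<noteq> 0"
    by (metis add_pos_nonneg less_irrefl zero_le_power2 zero_less_one)
  then have "of_real (1 + s^2) \<noteq> (0 :: 'k)"
    by (metis of_real_eq_0_iff)
  then show ?thesis by simp
qed


section \<open>The projector and its charge\<close>

lemma sphere_subring: "subring (sphere q s) (SUq2 q)"
  unfolding sphere_def
  by (rule ring.generate_ring_is_subring[OF ring_SUq2]) (auto simp: xi_def eta_def zeta_def Let_def)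

lemma sphere_generators:
  "cls q (scalar c) \<in> sphere q s" "xi q s \<in> sphere q s" "eta q s \<in> sphere q s" "zeta q s \<in> sphere q s"
  unfolding sphere_def by (auto intro: generate_ring.incl)

lemma sphere_closed:
  assumes "x \<in> sphere q s"
  shows "y \<in> sphere q s \<Longrightarrow> x \<oplus>\<^bsub>SUq2 q\<^esub> y \<in> sphere q s"
    "\<ominus>\<^bsub>SUq2 q\<^esub> x \<in> sphere q s"
    "y \<in> sphere q s \<Longrightarrow> x \<ominus>\<^bsub>SUq2 q\<^esub> y \<in> sphere q s"
    "scale q c x \<in> sphere q s"
  using assms subringE(5-7)[OF sphere_subring[of q s]] sphere_generators(1)[of q c s]
  by (auto simp: scale_def a_minus_def)

lemma one_in_sphere: "\<one>\<^bsub>SUq2 q\<^esub> \<in> sphere q s"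
  by (rule subringE(3)[OF sphere_subring])

lemma is_projector_line_bundle_projector:
  fixes q :: "'k::real_normed_field"
  assumes q: "q \<noteq> 0"
  shows "is_projector (SUq2 q) (sphere q s) (bundle_gen1 q s) (bundle_gen2 q s)
    (line_bundle q s) (line_bundle_projector q s)"
proof -
  define t p n :: 'k where "t = of_real s" and "p = inverse q" and "n = inverse (1 + t^2)"
  define w1 where "w1 = gen Delta - scalar (t * q) * gen Gamma"
  define w2 where "w2 = scalar t * gen Alpha - scalar p * gen Beta"
  have n: "n * (1 + t^2) = 1"
    using one_plus_of_real_square_neq_0[of s, where 'k = 'k] by (simp add: n_def t_def)
  let ?u = "bundle_gen1 q s" and ?v = "bundle_gen2 q s"
  let ?w1 = "scale q n (cls q w1)" and ?w2 = "scale q n (cls q w2)"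
  note entries = rank_one_entries[OF p_def q, of t, folded w1_def w2_def]
  have scale_out: "cls q (gen g + scalar k * gen h) \<otimes>\<^bsub>SUq2 q\<^esub> scale q n (cls q w)
      = scale q n (cls q ((gen g + scalar k * gen h) * w))" for g h k w
    by (simp add: scale_def cls_mult scalar_normalize)
  have e: "line_bundle_projector q s =
      ((?u \<otimes>\<^bsub>SUq2 q\<^esub> ?w1, ?u \<otimes>\<^bsub>SUq2 q\<^esub> ?w2), (?v \<otimes>\<^bsub>SUq2 q\<^esub> ?w1, ?v \<otimes>\<^bsub>SUq2 q\<^esub> ?w2))"
    unfolding bundle_gen1_def bundle_gen2_def scale_out t_def[symmetric] entries
    by (simp add: line_bundle_projector_def Let_def xi_def eta_def zeta_def scale_def
        cls_ring_simps t_def n_def p_def)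
  have dual: "?w1 \<otimes>\<^bsub>SUq2 q\<^esub> ?u \<oplus>\<^bsub>SUq2 q\<^esub> ?w2 \<otimes>\<^bsub>SUq2 q\<^esub> ?v = \<one>\<^bsub>SUq2 q\<^esub>"
  proof -
    have "?w1 \<otimes>\<^bsub>SUq2 q\<^esub> ?u \<oplus>\<^bsub>SUq2 q\<^esub> ?w2 \<otimes>\<^bsub>SUq2 q\<^esub> ?v = scale q n
        (cls q (w1 * (gen Alpha + scalar t * gen Beta) + w2 * (gen Gamma + scalar t * gen Delta)))"
      by (simp add: scale_def bundle_gen1_def bundle_gen2_def cls_mult cls_add t_def
          distrib_left mult.assoc)
    also have "\<dots> = cls q (scalar (n * (1 + t^2)))"
      unfolding entries by (simp add: scale_def cls_mult scalar_hom(1))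
    finally show ?thesis
      by (simp add: n scalar_hom(4) cls_one)
  qed
  have "line_bundle_projector q s \<in> (sphere q s \<times> sphere q s) \<times> (sphere q s \<times> sphere q s)"
    by (auto simp: line_bundle_projector_def Let_def
        intro!: sphere_closed sphere_generators one_in_sphere)
  then show ?thesis
    unfolding line_bundle_def
    by (intro ring.is_projector_of_dual_pair[OF ring_SUq2 sphere_subring _ _ _ _ dual e])
      (auto simp: e scale_def bundle_gen1_def bundle_gen2_def cls_mult)
qed

lemma chern_number_line_bundle_projector:
  fixes q :: "'k::real_normed_field"
  assumes q: "q \<noteq> 0" "q^2 \<noteq> 1"
    and \<tau>: "linear_trace q (sphere q s) \<tau>" "\<tau> \<one>\<^bsub>SUq2 q\<^esub> = 0"
      "\<tau> (zeta q s) = (1 + (of_real s)^2) / (1 - (inverse q)^2)"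
  shows "chern_number q \<tau> (line_bundle_projector q s) = -1"
proof -
  interpret ring "SUq2 q" by (rule ring_SUq2)
  note [simp] = sphere_generators sphere_closed one_in_sphere
  have add: "\<tau> (x \<oplus>\<^bsub>SUq2 q\<^esub> y) = \<tau> x + \<tau> y" if "x \<in> sphere q s" "y \<in> sphere q s" for x y
    using \<tau>(1) that by (simp add: linear_trace_def)
  have scale: "\<tau> (scale q c x) = c * \<tau> x" if "x \<in> sphere q s" for c x
    using \<tau>(1) that by (simp add: linear_trace_def)
  have const: "\<tau> (cls q (scalar c)) = 0" for c
    using scale[of "\<one>\<^bsub>SUq2 q\<^esub>" c] \<tau>(2) by (simp add: scale_def)
  have diff: "\<tau> (\<one>\<^bsub>SUq2 q\<^esub> \<ominus>\<^bsub>SUq2 q\<^esub> zeta q s) = - \<tau> (zeta q s)"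
  proof -
    have "zeta q s \<in> carrier (SUq2 q)"
      by (simp add: zeta_def Let_def)
    then have "(\<one>\<^bsub>SUq2 q\<^esub> \<ominus>\<^bsub>SUq2 q\<^esub> zeta q s) \<oplus>\<^bsub>SUq2 q\<^esub> zeta q s = \<one>\<^bsub>SUq2 q\<^esub>"
      by (simp add: a_minus_def a_assoc l_neg)
    then show ?thesis
      using add[of "\<one>\<^bsub>SUq2 q\<^esub> \<ominus>\<^bsub>SUq2 q\<^esub> zeta q s" "zeta q s"] \<tau>(2)
      by (simp add: eq_neg_iff_add_eq_0)
  qed
  define A D :: 'k where "A = 1 + (of_real s)^2" and "D = 1 - (inverse q)^2"
  have nz: "A \<noteq> 0" "D \<noteq> 0"
    using q one_plus_of_real_square_neq_0[of s, where 'k = 'k]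
    by (simp_all add: A_def D_def field_simps)
  have "chern_number q \<tau> (line_bundle_projector q s) = inverse A * (- D) * \<tau> (zeta q s)"
    by (simp add: chern_number_def line_bundle_projector_def mat_tr_def Let_def
        add scale const diff algebra_simps A_def D_def)
  also have "\<dots> = - 1"
    using nz by (simp add: \<tau>(3) flip: A_def D_def)
  finally show ?thesis .
qed

theorem mainTheorem2:
  fixes q :: "'k::real_normed_field" and s :: real
  assumes "q \<noteq> 0" and "q^2 \<noteq> 1" and "s \<in> {0..1}"
  shows "is_projector (SUq2 q) (sphere q s) (bundle_gen1 q s) (bundle_gen2 q s)
           (line_bundle q s) (line_bundle_projector q s)
         \<and> (\<forall>\<tau> :: 'k free set \<Rightarrow> 'k.
              linear_trace q (sphere q s) \<tau> \<longrightarrow>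
              \<tau> \<one>\<^bsub>SUq2 q\<^esub> = 0 \<longrightarrow>
              \<tau> (zeta q s) = (1 + (of_real s)^2) / (1 - (inverse q)^2) \<longrightarrow>
              chern_number q \<tau> (line_bundle_projector q s) = -1)"
  using assms is_projector_line_bundle_projector chern_number_line_bundle_projector by blast

end
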